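(* Let $E$ be the elliptic curve over $\mathbb{Q}$ given by $y^2=x^3+Ax+B$ with $$A=1123187040185717205972,\qquad B=50786893859117937639786031372848.$$ Then the Mordell–Weil group $E(\mathbb{Q})$ has rank at least $6$. *)

theory Defs
  imports Complex_Main "HOL-Algebra.FiniteProduct" "HOL-Library.Extended_Nat"
begin

section \<open>Elliptic curves in short Weierstrass form\<close>

text \<open>
  A pair \<open>A B\<close> of field elements stands for the projective closure of \<open>y\<^sup>2 = x\<^sup>3 + A x + B\<close>;
  its only point outside the affine chart is \<open>Infinity\<close>, the neutral element of the group law.
\<close>

datatype 'a ec_point = Infinity | Affine 'a 'a

text \<open>Nonsingularity of the curve.\<close>

definition elliptic_curve :: "'a::field_char_0 \<Rightarrow> 'a \<Rightarrow> bool" where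
  "elliptic_curve A B \<longleftrightarrow> 4 * A ^ 3 + 27 * B ^ 2 \<noteq> 0"

definition ec_points :: "'a::field_char_0 \<Rightarrow> 'a \<Rightarrow> 'a ec_point set" where
  "ec_points A B = insert Infinity {Affine x y | x y. y ^ 2 = x ^ 3 + A * x + B}"

text \<open>
  Chord-and-tangent addition. For two affine points with the same \<open>x\<close>-coordinate on the curve,
  either \<open>y\<^sub>2 = - y\<^sub>1\<close> (vertical line, which includes the tangent at a point with \<open>y\<^sub>1 = 0\<close>)
  or \<open>y\<^sub>2 = y\<^sub>1 \<noteq> 0\<close>, where \<open>l\<close> is the slope of the tangent. The values of \<open>ec_add\<close> at points
  off the curve are irrelevant.
\<close>

fun ec_add :: "'a::field_char_0 \<Rightarrow> 'a ec_point \<Rightarrow> 'a ec_point \<Rightarrow> 'a ec_point" where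
  "ec_add A Infinity Q = Q"
| "ec_add A P Infinity = P"
| "ec_add A (Affine x1 y1) (Affine x2 y2) =
    (if x1 = x2 \<and> y1 = - y2 then Infinity
     else let l = (if x1 = x2 then (3 * x1 ^ 2 + A) / (2 * y1) else (y2 - y1) / (x2 - x1));
              x3 = l ^ 2 - x1 - x2
          in Affine x3 (l * (x1 - x3) - y1))"

definition mordell_weil :: "'a::field_char_0 \<Rightarrow> 'a \<Rightarrow> 'a ec_point monoid" where
  "mordell_weil A B = \<lparr>carrier = ec_points A B, mult = ec_add A, one = Infinity\<rparr>"


section \<open>Rank of an abelian group\<close>

text \<open>
  Groups are written multiplicatively as in HOL-Algebra, so the product below is the
  integer linear combination \<open>\<Sum>P\<in>S. n P \<cdot> P\<close>. The rank (which equals \<open>dim\<^sub>\<rat> (G \<otimes> \<rat>)\<close>) is the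
  supremum, possibly \<open>\<infinity>\<close>, of the cardinalities of finite \<open>\<int>\<close>-linearly independent subsets.
\<close>

definition int_independent :: "('a, 'b) monoid_scheme \<Rightarrow> 'a set \<Rightarrow> bool" where
  "int_independent G S \<longleftrightarrow> finite S \<and> S \<subseteq> carrier G \<and>
    (\<forall>n :: 'a \<Rightarrow> int. finprod G (\<lambda>P. P [^]\<^bsub>G\<^esub> n P) S = \<one>\<^bsub>G\<^esub> \<longrightarrow> (\<forall>P\<in>S. n P = 0))"

definition abelian_group_rank :: "('a, 'b) monoid_scheme \<Rightarrow> enat" where
  "abelian_group_rank G = (SUP S \<in> {S. int_independent G S}. enat (card S))"


text \<open>The curve of the main theorem is nonsingular.\<close>

lemma elliptic_curve_example:
  "elliptic_curve (1123187040185717205972 :: rat) 50786893859117937639786031372848"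
  by (simp add: elliptic_curve_def)

end

theory Submission
  imports Defs "HOL-Number_Theory.Number_Theory" "HOL-Computational_Algebra.Polynomial"
begin

text \<open>
  Sending an affine point with abscissa \<open>x\<close> to \<open>x - X\<close> modulo the squares of \<open>\<rat>[X]/(X\<^sup>3 + A X + B)\<close>
  is a homomorphism that kills doubles. At a prime \<open>p\<close> where the cubic has a simple root \<open>r\<close>, the
  quadratic character of \<open>x - r\<close> modulo \<open>p\<close> is well defined on these classes. Six points (found by a
  sieve search for integral points) and six pairs \<open>(p, r)\<close> are chosen so that the matrix of
  characters is \<open>-1\<close> on the diagonal and \<open>1\<close> elsewhere. Hence every relation between the points has
  even coefficients; as the cubic is irreducible there is no 2-torsion, the relation can be halved,
  and descent shows that it is trivial.
\<close>

section \<open>The group law\<close>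

text \<open>
  \<open>chord A B l m x\<^sub>1 x\<^sub>2 x\<^sub>3\<close> lists the coefficients of the identity
  \<open>(X\<^sup>3 + A X + B) - (l X + m)\<^sup>2 = (X - x\<^sub>1) (X - x\<^sub>2) (X - x\<^sub>3)\<close>, so that the line \<open>y = l x + m\<close> meets the
  curve at these three abscissae with multiplicity; tangents need no separate treatment.
\<close>

definition chord :: "'a::field_char_0 \<Rightarrow> 'a \<Rightarrow> 'a \<Rightarrow> 'a \<Rightarrow> 'a \<Rightarrow> 'a \<Rightarrow> 'a \<Rightarrow> bool" where
  "chord A B l m x1 x2 x3 \<longleftrightarrow> l^2 = x1 + x2 + x3 \<and>
     A - 2 * l * m = x1 * x2 + x1 * x3 + x2 * x3 \<and> m^2 - B = x1 * x2 * x3"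

lemma chord_swap12: "chord A B l m x1 x2 x3 \<Longrightarrow> chord A B l m x2 x1 x3"
  and chord_swap23: "chord A B l m x1 x2 x3 \<Longrightarrow> chord A B l m x1 x3 x2"
  by (auto simp: chord_def algebra_simps)

text \<open>A chord is determined by \<open>l\<close>, \<open>m\<close>, \<open>x1\<close>,
  \<open>x2\<close>. Eliminating \<open>x3\<close>, \<open>A\<close> and \<open>B\<close> in their
  favour turns later claims into polynomial identities decided by ring normalisation.\<close>

lemma chord_eqs:
  assumes "chord A B l m x1 x2 x3"
  shows "x3 = l^2 - x1 - x2" "A = 2 * l * m + x1 * x2 + (x1 + x2) * (l^2 - x1 - x2)"
    "B = m^2 - x1 * x2 * (l^2 - x1 - x2)"
proof -
  show x3: "x3 = l^2 - x1 - x2" using assms by (simp add: chord_def)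
  show "A = 2 * l * m + x1 * x2 + (x1 + x2) * (l^2 - x1 - x2)"
    and "B = m^2 - x1 * x2 * (l^2 - x1 - x2)"
    using assms unfolding x3[symmetric] by (auto simp: chord_def algebra_simps)
qed

lemma chord_factor:
  assumes "chord A B l m x1 x2 x3"
  shows "(l * x + m)^2 - (x^3 + A * x + B) = - ((x - x1) * (x - x2) * (x - x3))"
  unfolding chord_eqs(2,3)[OF assms] unfolding chord_eqs(1)[OF assms]
  by (simp add: power2_eq_square power3_eq_cube algebra_simps)

lemma chord_on_curve:
  assumes "chord A B l m x1 x2 x3"
  shows "(l * x1 + m)^2 = x1^3 + A * x1 + B" "(l * x2 + m)^2 = x2^3 + A * x2 + B"
    "(l * x3 + m)^2 = x3^3 + A * x3 + B"
  using chord_factor[OF assms, of x1] chord_factor[OF assms, of x2] chord_factor[OF assms, of x3]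
  by simp_all

text \<open>Bridge from the case distinction in \<open>ec_add\<close> to the uniform
  \<open>chord\<close>. The last clause keeps the tangent slope, which the ordinates at
  \<open>x1 = x2\<close> do not determine.\<close>

lemma chord_exists:
  fixes A B :: "'a::field_char_0"
  assumes "y1^2 = x1^3 + A * x1 + B" "y2^2 = x2^3 + A * x2 + B" and ne: "\<not> (x1 = x2 \<and> y1 = - y2)"
  obtains l m x3 where "chord A B l m x1 x2 x3" "y1 = l * x1 + m" "y2 = l * x2 + m"
    "ec_add A (Affine x1 y1) (Affine x2 y2) = Affine x3 (- (l * x3 + m))"
    "x1 = x2 \<Longrightarrow> 2 * y1 * l = 3 * x1^2 + A"
proof -
  define l where "l = (if x1 = x2 then (3 * x1 ^ 2 + A) / (2 * y1) else (y2 - y1) / (x2 - x1))"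
  define m where "m = y1 - l * x1"
  define x3 where "x3 = l^2 - x1 - x2"
  have tangent: "y1 = y2 \<and> y1 \<noteq> 0 \<and> 2 * y1 * l = 3 * x1^2 + A" if "x1 = x2"
  proof -
    have "y1^2 = y2^2" using assms that by simp
    then have "y1 = y2" using ne that by (auto simp: power2_eq_iff)
    moreover from this have "y1 \<noteq> 0" using ne that by auto
    ultimately show ?thesis using that by (simp add: l_def)
  qed
  have y2: "y2 = l * x2 + m"
  proof (cases "x1 = x2")
    case False
    then have "l * (x2 - x1) = y2 - y1" by (simp add: l_def)
    then show ?thesis by (simp add: m_def algebra_simps)
  qed (use tangent in \<open>simp add: m_def\<close>)
  have y1: "y1 = l * x1 + m" by (simp add: m_def)
  have e2: "A - 2 * l * m = x1 * x2 + x1 * x3 + x2 * x3"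
  proof (cases "x1 = x2")
    case True
    have "A = 2 * y1 * l - 3 * x1^2" using tangent[OF True] by (metis add_diff_cancel_left')
    then show ?thesis using True
      by (simp add: m_def x3_def power2_eq_square algebra_simps)
  next
    case False
    \<comment> \<open>Subtracting the curve equations at the two points leaves a multiple of
      \<open>x2 - x1\<close>, whose cofactor is the wanted relation.\<close>
    have "(x2 - x1) * (A - 2 * l * m - (x1 * x2 + x1 * x3 + x2 * x3))
        = (x2^3 + A * x2 + B - (l * x2 + m)^2) - (x1^3 + A * x1 + B - (l * x1 + m)^2)"
      by (simp add: x3_def power2_eq_square power3_eq_cube algebra_simps)
    also have "\<dots> = 0" using assms(1,2) by (simp flip: y1 y2)
    finally have "(x2 - x1) * (A - 2 * l * m - (x1 * x2 + x1 * x3 + x2 * x3)) = 0" .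
    then show ?thesis using False by simp
  qed
  have "m^2 - B = x1 * x2 * x3"
  proof -
    have "m^2 - B = (l * x1 + m)^2 - B - l^2 * x1^2 - 2 * l * m * x1"
      by (simp add: power2_eq_square algebra_simps)
    also have "\<dots> = x1^3 + A * x1 - l^2 * x1^2 - 2 * l * m * x1"
      using assms(1) by (simp flip: y1)
    also have "\<dots> = x1^3 - l^2 * x1^2 + (A - 2 * l * m) * x1"
      by (simp add: algebra_simps)
    also have "\<dots> = x1 * x2 * x3"
      unfolding e2 by (simp add: x3_def power2_eq_square power3_eq_cube algebra_simps)
    finally show ?thesis .
  qed
  with e2 have "chord A B l m x1 x2 x3" by (simp add: chord_def x3_def)
  moreover have "ec_add A (Affine x1 y1) (Affine x2 y2) = Affine x3 (- (l * x3 + m))"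
  proof -
    have "ec_add A (Affine x1 y1) (Affine x2 y2) = Affine x3 (l * (x1 - x3) - y1)"
      using ne unfolding ec_add.simps Let_def l_def[symmetric] x3_def[symmetric] by simp
    then show ?thesis by (simp add: m_def algebra_simps)
  qed
  ultimately show ?thesis using that y1 y2 tangent by blast
qed

text \<open>
  Nonsingularity is needed only here: a line through a point with \<open>y = 0\<close> twice forces a double
  root of the cubic.
\<close>

lemma ec_add_chord:
  fixes A B :: "'a::field_char_0"
  assumes "elliptic_curve A B" and ch: "chord A B l m x1 x2 x3"
  shows "ec_add A (Affine x1 (l * x1 + m)) (Affine x2 (l * x2 + m)) = Affine x3 (- (l * x3 + m))"
proof -
  have ne: "\<not> (x1 = x2 \<and> l * x1 + m = - (l * x2 + m))"
  proof
    assume "x1 = x2 \<and> l * x1 + m = - (l * x2 + m)"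
    then have eq: "x2 = x1" and "(l * x1 + m) + (l * x1 + m) = 0"
      by (auto simp only: eq_neg_iff_add_eq_0)
    then have "2 * (l * x1 + m) = 0" by (simp only: mult_2)
    then have "l * x1 + m = 0" by (simp only: mult_eq_0_iff) simp
    then have m: "m = - (l * x1)" by (simp only: eq_neg_iff_add_eq_0 add.commute)
    \<comment> \<open>The cubic is now \<open>(X - x1)^2 (X + 2 x1)\<close>, so its discriminant
      vanishes.\<close>
    have A: "A = - 3 * x1^2"
      unfolding chord_eqs(2)[OF ch] by (simp add: eq m power2_eq_square algebra_simps)
    have B: "B = 2 * x1^3"
      unfolding chord_eqs(3)[OF ch]
      by (simp add: eq m power2_eq_square power3_eq_cube algebra_simps)
    show False
      using assms(1) by (simp add: elliptic_curve_def A B power_mult_distrib flip: power_mult)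
  qed
  obtain l' m' x3' where c: "chord A B l' m' x1 x2 x3'" "l * x1 + m = l' * x1 + m'"
      "l * x2 + m = l' * x2 + m'"
      "ec_add A (Affine x1 (l * x1 + m)) (Affine x2 (l * x2 + m)) = Affine x3' (- (l' * x3' + m'))"
      "x1 = x2 \<Longrightarrow> 2 * (l * x1 + m) * l' = 3 * x1^2 + A"
    using chord_exists[OF chord_on_curve(1,2)[OF ch] ne] by metis
  \<comment> \<open>The line is unique: distinct abscissae fix its slope, and at a double point the
    tangent relation does, the ordinate being nonzero.\<close>
  have "l' = l"
  proof (cases "x1 = x2")
    case False
    have "(l - l') * (x1 - x2) = (l * x1 + m - (l * x2 + m)) - (l' * x1 + m' - (l' * x2 + m'))"
      by (simp add: algebra_simps)
    also have "\<dots> = 0" using c(2,3) by simp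
    finally have "(l - l') * (x1 - x2) = 0" .
    then show ?thesis using False by simp
  next
    case True
    have "2 * (l * x1 + m) * l = 3 * x1^2 + A"
      unfolding chord_eqs(2)[OF ch] using True by (simp add: power2_eq_square algebra_simps)
    then have "2 * (l * x1 + m) * l' = 2 * (l * x1 + m) * l" using c(5) True by simp
    moreover have "l * x1 + m \<noteq> 0" using ne True by (metis minus_zero)
    ultimately show ?thesis by (simp only: mult_cancel_left mult_eq_0_iff) simp
  qed
  moreover from this have "m' = m" using c(2) by simp
  moreover have "x3' = x3" using c(1) ch \<open>l' = l\<close> by (auto simp: chord_def)
  ultimately show ?thesis using c(4) by simp
qed

text \<open>
  Let the lines \<open>y = l x + m\<close> and \<open>y = l' x + m'\<close> pass through \<open>-U\<close> and \<open>U\<close>, where \<open>U\<close> has abscissa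
  \<open>u\<close>. The product of their equations is divisible by \<open>X - u\<close> modulo the curve; the quotient
  \<open>X\<^sup>2 + (u + l l') X + (A + l m' + l' m + u (u + l l')) - (l + l') Y\<close> vanishes at the remaining
  intersection points.
\<close>

lemma chord_quotient_vanishes:
  fixes A B :: "'a::field_char_0"
  assumes "chord A B l m x1 x2 u" "l' * u + m' = - (l * u + m)"
  shows "x1^2 + (u + l * l') * x1 + (A + l * m' + l' * m + u * (u + l * l')) = (l + l') * (l * x1 + m)"
proof -
  have m': "m' = - (l * u + m) - l' * u" using assms(2) by (simp add: algebra_simps)
  show ?thesis
    unfolding m' chord_eqs(2)[OF assms(1)] unfolding chord_eqs(1)[OF assms(1)]
    by (simp add: power2_eq_square algebra_simps)
qed

text \<open>
  Both sides of the associative law are read off the fourth zero of such a quotient vanishing at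
  \<open>P, Q, R\<close>. The difference of the two quotients is linear, and would be a line through the three
  points unless it is zero.
\<close>

lemma chords_assoc:
  fixes A B :: "'a::field_char_0"
  assumes c1: "chord A B l1 m1 x1 x2 u" and c2: "chord A B l2 m2 x2 x3 v"
    and c3: "chord A B l3 m3 u x3 s" and c4: "chord A B l4 m4 x1 v t"
    and u: "l3 * u + m3 = - (l1 * u + m1)" and v: "l4 * v + m4 = - (l2 * v + m2)"
    and y1: "y1 = l1 * x1 + m1" "y1 = l4 * x1 + m4"
    and y2: "y2 = l1 * x2 + m1" "y2 = l2 * x2 + m2"
    and y3: "y3 = l2 * x3 + m2" "y3 = l3 * x3 + m3"
    and x3: "x3 \<noteq> x1" "x3 \<noteq> x2" "x3 = u \<Longrightarrow> y3 \<noteq> l1 * u + m1"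
    and x1: "x1 = x2 \<Longrightarrow> v \<noteq> x1"
  shows "s = t \<and> l3 * s + m3 = l4 * t + m4"
proof -
  \<comment> \<open>Coefficients of the quotient \<open>X^2 + a X + b - c Y\<close> of chords 1 and
    3, which pass through -(P+Q) and P+Q over \<open>u\<close>, and of the primed one of chords 2
    and 4, which pass through -(Q+R) and Q+R over \<open>v\<close>.\<close>
  define a b c a' b' c' where abc: "a = u + l1 * l3" "b = A + l1 * m3 + l3 * m1 + u * (u + l1 * l3)"
    "c = l1 + l3" "a' = v + l2 * l4" "b' = A + l2 * m4 + l4 * m2 + v * (v + l2 * l4)" "c' = l2 + l4"
  have u': "l1 * u + m1 = - (l3 * u + m3)" and v': "l2 * v + m2 = - (l4 * v + m4)"
    using u v by simp_all
  have c3': "chord A B l3 m3 x3 s u" "chord A B l3 m3 s x3 u"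
    and c4': "chord A B l4 m4 x1 t v" "chord A B l4 m4 t x1 v"
    using c3 c4 chord_swap12 chord_swap23 by blast+
  have g1: "x1^2 + a * x1 + b = c * y1" and g2: "x2^2 + a * x2 + b = c * y2"
    using chord_quotient_vanishes[OF c1 u] chord_quotient_vanishes[OF chord_swap12[OF c1] u]
    by (simp_all add: abc y1(1) y2(1))
  have g3: "x3^2 + a * x3 + b = c * y3" and gs: "s^2 + a * s + b = c * (l3 * s + m3)"
    using chord_quotient_vanishes[OF c3'(1) u'] chord_quotient_vanishes[OF c3'(2) u']
    by (simp_all add: abc y3(2) ac_simps)
  have h2: "x2^2 + a' * x2 + b' = c' * y2" and h3: "x3^2 + a' * x3 + b' = c' * y3"
    using chord_quotient_vanishes[OF c2 v] chord_quotient_vanishes[OF chord_swap12[OF c2] v]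
    by (simp_all add: abc y2(2) y3(1))
  have h1: "x1^2 + a' * x1 + b' = c' * y1" and ht: "t^2 + a' * t + b' = c' * (l4 * t + m4)"
    using chord_quotient_vanishes[OF c4'(1) v'] chord_quotient_vanishes[OF c4'(2) v']
    by (simp_all add: abc y1(2) ac_simps)
  \<comment> \<open>If P = Q, both quotients vanish doubly at P, so their derivatives along the
    slope \<open>l1\<close> are zero. In the primed one, chords 2 and 4 contribute one zero each;
    the claim is shown after multiplication by \<open>v - x1\<close>.\<close>
  have tangent: "2 * x1 + a = c * l1 \<and> 2 * x1 + a' = c' * l1" if "x1 = x2"
  proof
    show "2 * x1 + a = c * l1"
      using c1 that by (simp add: chord_def abc power2_eq_square algebra_simps)
    have "y1 = l2 * x1 + m2" using y1 y2 that by simp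
    have "l4 * (v - x1) = (l4 * v + m4) - (l4 * x1 + m4)" by (simp add: algebra_simps)
    also have "\<dots> = - (l2 * v + m2) - (l2 * x1 + m2)"
      using v y1(2) \<open>y1 = l2 * x1 + m2\<close> by simp
    also have "\<dots> = - 2 * (l2 * x1 + m2) - l2 * (v - x1)" by (simp add: algebra_simps)
    finally have e1: "l4 * (v - x1) = - 2 * y1 - l2 * (v - x1)"
      using \<open>y1 = l2 * x1 + m2\<close> by simp
    have "2 * y1 * l1 = 3 * x1^2 + A"
      unfolding y1(1) chord_eqs(2)[OF c1] using that by (simp add: power2_eq_square algebra_simps)
    moreover have "2 * y1 * l2 = 3 * x1^2 + A - (x1 - x3) * (x1 - v)"
      unfolding \<open>y1 = l2 * x1 + m2\<close> chord_eqs(1,2)[OF c2] using that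
      by (simp add: power2_eq_square algebra_simps)
    ultimately have e2: "2 * y1 * (l1 - l2) = (x1 - x3) * (x1 - v)" by (simp add: algebra_simps)
    have e3: "l2^2 = x1 + x3 + v" using c2 that by (simp add: chord_def)
    have "(v - x1) * (2 * x1 + a' - c' * l1)
        = (v - x1) * (2 * x1 + v) + l2 * (l4 * (v - x1)) - (l2 * (v - x1) + l4 * (v - x1)) * l1"
      by (simp add: abc algebra_simps)
    also have "\<dots> = (v - x1) * (2 * x1 + v - l2^2) + 2 * y1 * (l1 - l2)"
      unfolding e1 by (simp add: power2_eq_square algebra_simps)
    also have "\<dots> = 0" unfolding e2 e3 by (simp add: algebra_simps)
    finally have "(v - x1) * (2 * x1 + a' - c' * l1) = 0" .
    then show "2 * x1 + a' = c' * l1" using x1 that by simp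
  qed
  have c_eq: "c' = c"
  proof (rule ccontr)
    assume "c' \<noteq> c"
    define l m where "l = (a' - a) / (c' - c)" and "m = (b' - b) / (c' - c)"
    have on_line: "y = l * x + m" if "x^2 + a * x + b = c * y" "x^2 + a' * x + b' = c' * y" for x y
    proof -
      have "(c' - c) * y = (a' - a) * x + (b' - b)"
        using that by (simp add: left_diff_distrib flip: that)
      then have "y = ((a' - a) * x + (b' - b)) / (c' - c)"
        using \<open>c' \<noteq> c\<close> by (simp add: field_simps)
      then show ?thesis by (simp add: l_def m_def add_divide_distrib)
    qed
    have lin: "y1 = l * x1 + m" "y2 = l * x2 + m" "y3 = l * x3 + m"
      using on_line g1 g2 g3 h1 h2 h3 by blast+
    \<comment> \<open>The difference line is therefore chord 1, which puts R on chord 1 and makes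
      \<open>x3\<close> one of \<open>x1\<close>, \<open>x2\<close>, \<open>u\<close>.\<close>
    have "l = l1"
    proof (cases "x1 = x2")
      case True
      have "a' - a = (2 * x1 + a') - (2 * x1 + a)" by simp
      also have "\<dots> = l1 * (c' - c)" using tangent[OF True] by (simp add: algebra_simps)
      finally have "a' - a = l1 * (c' - c)" .
      then show ?thesis using \<open>c' \<noteq> c\<close> by (simp add: l_def)
    next
      case False
      have "(l - l1) * (x1 - x2) = (l * x1 + m - (l * x2 + m)) - (l1 * x1 + m1 - (l1 * x2 + m1))"
        by (simp add: algebra_simps)
      also have "\<dots> = 0" by (simp flip: lin y1(1) y2(1))
      finally have "(l - l1) * (x1 - x2) = 0" .
      then show ?thesis using False by simp
    qed
    then have "y3 = l1 * x3 + m1" using lin y1 by simp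
    moreover have "(l3 * x3 + m3)^2 = x3^3 + A * x3 + B" using chord_on_curve(2)[OF c3] .
    ultimately have "(x3 - x1) * (x3 - x2) * (x3 - u) = 0"
      using chord_factor[OF c1, of x3] y3 by simp
    then show False using x3 \<open>y3 = l1 * x3 + m1\<close> by auto
  qed
  have a_eq: "a' = a" and b_eq: "b' = b"
  proof -
    have *: "a' * x1 + b' = a * x1 + b" "a' * x3 + b' = a * x3 + b"
      using g1 g3 h1 h3 c_eq by (simp_all flip: g1 g3 add: algebra_simps)
    have "(a' - a) * (x3 - x1) = (a' * x3 + b' - (a * x3 + b)) - (a' * x1 + b' - (a * x1 + b))"
      by (simp add: algebra_simps)
    then show "a' = a" using x3 * by simp
    then show "b' = b" using * by simp
  qed
  \<comment> \<open>Adding the two slope equations \<open>l^2 = x1 + x2 + x3\<close> gives the sum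
    of the four abscissae where a quotient vanishes.\<close>
  have "s = c^2 - 2 * a - x1 - x2 - x3"
    using c1 c3 by (simp add: abc chord_def power2_sum)
  moreover have "t = c'^2 - 2 * a' - x1 - x2 - x3"
    using c2 c4 by (simp add: abc chord_def power2_sum)
  ultimately have st: "s = t" by (simp add: a_eq c_eq)
  \<comment> \<open>Needed to recover the ordinate. With \<open>c = 0\<close> all abscissae solve
    one quadratic, so \<open>x1 = x2\<close> because \<open>x3\<close> differs from both; by
    tangency this root is double and equals \<open>x3\<close>.\<close>
  have "c \<noteq> 0"
  proof
    assume c: "c = 0"
    have root: "x3 + x + a = 0" if "x3 \<noteq> x" "x^2 + a * x + b = 0" for x
    proof -
      have "(x3 - x) * (x3 + x + a) = (x3^2 + a * x3 + b) - (x^2 + a * x + b)"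
        by (simp add: power2_eq_square algebra_simps)
      then show ?thesis using g3 c that by simp
    qed
    have *: "x3 + x1 + a = 0" "x3 + x2 + a = 0" using root x3 g1 g2 c by simp_all
    then have "x1 = x2" by (metis add_left_cancel add_right_cancel)
    then have "2 * x1 + a = x3 + x1 + a" using tangent c * by simp
    then show False using x3 by simp
  qed
  moreover have "c * (l3 * s + m3) = c * (l4 * t + m4)"
    using gs ht by (simp add: st a_eq b_eq c_eq)
  ultimately show ?thesis using st by simp
qed

section \<open>Negation and the abelian group axioms\<close>

fun ec_neg :: "'a::field_char_0 ec_point \<Rightarrow> 'a ec_point" where
  "ec_neg Infinity = Infinity"
| "ec_neg (Affine x y) = Affine x (- y)"

lemma ec_neg_neg [simp]: "ec_neg (ec_neg P) = P"
  by (cases P) auto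

lemma Affine_in_ec_points [simp]: "Affine x y \<in> ec_points A B \<longleftrightarrow> y^2 = x^3 + A * x + B"
  and Infinity_in_ec_points [simp]: "Infinity \<in> ec_points A B"
  by (auto simp: ec_points_def)

lemma ec_neg_closed [simp]: "ec_neg P \<in> ec_points A B \<longleftrightarrow> P \<in> ec_points A B"
  by (cases P) auto

lemma ec_add_Infinity_right [simp]: "ec_add A P Infinity = P"
  by (cases P) auto

lemma ec_add_neg [simp]: "ec_add A P (ec_neg P) = Infinity"
  by (cases P) auto

lemma ec_neg_add_self [simp]: "ec_add A (ec_neg P) P = Infinity"
  by (cases P) auto

lemma same_x_cases:
  assumes "Affine x y \<in> ec_points A B" "Affine x y' \<in> ec_points A B"
  shows "Affine x y = Affine x y' \<or> Affine x y = ec_neg (Affine x y')"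
proof -
  have "y^2 = y'^2" using assms by simp
  then show ?thesis by (simp add: power2_eq_iff)
qed

lemma ec_add_chord_exists:
  assumes "Affine x1 y1 \<in> ec_points A B" "Affine x2 y2 \<in> ec_points A B"
    "Affine x1 y1 \<noteq> ec_neg (Affine x2 y2)"
  obtains l m x3 where "chord A B l m x1 x2 x3" "y1 = l * x1 + m" "y2 = l * x2 + m"
    "ec_add A (Affine x1 y1) (Affine x2 y2) = Affine x3 (- (l * x3 + m))"
proof -
  have "\<not> (x1 = x2 \<and> y1 = - y2)" using assms(3) by simp
  then show ?thesis
    using chord_exists[of y1 x1 A B y2 x2] assms(1,2) that by (metis Affine_in_ec_points)
qed

locale weierstrass_curve =
  fixes A B :: "'a::field_char_0"
  assumes nonsingular: "elliptic_curve A B"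
begin

lemma ec_add_closed:
  assumes "P \<in> ec_points A B" "Q \<in> ec_points A B"
  shows "ec_add A P Q \<in> ec_points A B"
proof (cases "P = Infinity \<or> Q = Infinity \<or> P = ec_neg Q")
  case True
  then show ?thesis using assms by auto
next
  case False
  then obtain x1 y1 x2 y2 where PQ: "P = Affine x1 y1" "Q = Affine x2 y2"
    by (metis ec_point.exhaust)
  obtain l m x3 where "chord A B l m x1 x2 x3" "ec_add A P Q = Affine x3 (- (l * x3 + m))"
    using ec_add_chord_exists[of x1 y1 A B x2 y2] assms False PQ by metis
  then show ?thesis using chord_on_curve(3) by (simp only: Affine_in_ec_points power2_minus)
qed

lemma ec_add_commute:
  assumes "P \<in> ec_points A B" "Q \<in> ec_points A B"
  shows "ec_add A P Q = ec_add A Q P"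
proof (cases "P = Infinity \<or> Q = Infinity \<or> P = ec_neg Q")
  case True
  then show ?thesis by auto
next
  case False
  then obtain x1 y1 x2 y2 where PQ: "P = Affine x1 y1" "Q = Affine x2 y2"
    by (metis ec_point.exhaust)
  obtain l m x3 where "chord A B l m x1 x2 x3" "y1 = l * x1 + m" "y2 = l * x2 + m"
      "ec_add A P Q = Affine x3 (- (l * x3 + m))"
    using ec_add_chord_exists[of x1 y1 A B x2 y2] assms False PQ by metis
  then show ?thesis
    using ec_add_chord[OF nonsingular chord_swap12] PQ by metis
qed

text \<open>Reflection in the horizontal axis sends the line \<open>(l, m)\<close> to
  \<open>(- l, - m)\<close> and keeps the abscissae.\<close>

lemma ec_neg_add:
  assumes "P \<in> ec_points A B" "Q \<in> ec_points A B"
  shows "ec_neg (ec_add A P Q) = ec_add A (ec_neg P) (ec_neg Q)"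
proof (cases "P = Infinity \<or> Q = Infinity \<or> P = ec_neg Q")
  case True
  then show ?thesis by auto
next
  case False
  then obtain x1 y1 x2 y2 where PQ: "P = Affine x1 y1" "Q = Affine x2 y2"
    by (metis ec_point.exhaust)
  obtain l m x3 where c: "chord A B l m x1 x2 x3" "y1 = l * x1 + m" "y2 = l * x2 + m"
      "ec_add A P Q = Affine x3 (- (l * x3 + m))"
    using ec_add_chord_exists[of x1 y1 A B x2 y2] assms False PQ by metis
  have "chord A B (- l) (- m) x1 x2 x3" using c(1) by (simp add: chord_def)
  from ec_add_chord[OF nonsingular this] show ?thesis
    using PQ c by simp
qed

text \<open>The reflected line passes through P+Q, -Q and -P: the same three abscissae in reverse
  order.\<close>

lemma ec_add_minus_cancel:
  assumes "P \<in> ec_points A B" "Q \<in> ec_points A B"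
  shows "ec_add A (ec_add A P Q) (ec_neg Q) = P"
proof (cases "P = Infinity \<or> Q = Infinity \<or> P = ec_neg Q")
  case True
  then show ?thesis by auto
next
  case False
  then obtain x1 y1 x2 y2 where PQ: "P = Affine x1 y1" "Q = Affine x2 y2"
    by (metis ec_point.exhaust)
  obtain l m x3 where c: "chord A B l m x1 x2 x3" "y1 = l * x1 + m" "y2 = l * x2 + m"
      "ec_add A P Q = Affine x3 (- (l * x3 + m))"
    using ec_add_chord_exists[of x1 y1 A B x2 y2] assms False PQ by metis
  have "chord A B (- l) (- m) x3 x2 x1" using c(1) by (simp add: chord_def algebra_simps)
  from ec_add_chord[OF nonsingular this] show ?thesis
    using PQ c by simp
qed

text \<open>The hypotheses keep all four additions away from \<open>Infinity\<close> and give R an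
  abscissa different from those of P and Q. The case P = Q stays allowed.\<close>

lemma ec_add_assoc_generic:
  assumes P: "P \<in> ec_points A B" "P \<noteq> Infinity" and Q: "Q \<in> ec_points A B" "Q \<noteq> Infinity"
    and R: "R \<in> ec_points A B" "R \<noteq> Infinity"
    and PQ: "P \<noteq> ec_neg Q" and QR: "Q \<noteq> ec_neg R" "Q \<noteq> R" and PR: "P \<noteq> ec_neg R" "P \<noteq> R"
    and PQR: "ec_add A P Q \<noteq> ec_neg R" "P \<noteq> ec_neg (ec_add A Q R)"
  shows "ec_add A (ec_add A P Q) R = ec_add A P (ec_add A Q R)"
proof -
  obtain x1 y1 x2 y2 x3 y3 where xy: "P = Affine x1 y1" "Q = Affine x2 y2" "R = Affine x3 y3"
    using P Q R by (metis ec_point.exhaust)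
  obtain l1 m1 u where c1: "chord A B l1 m1 x1 x2 u" "y1 = l1 * x1 + m1" "y2 = l1 * x2 + m1"
      "ec_add A P Q = Affine u (- (l1 * u + m1))"
    using ec_add_chord_exists[of x1 y1 A B x2 y2] P Q PQ xy by metis
  obtain l2 m2 v where c2: "chord A B l2 m2 x2 x3 v" "y2 = l2 * x2 + m2" "y3 = l2 * x3 + m2"
      "ec_add A Q R = Affine v (- (l2 * v + m2))"
    using ec_add_chord_exists[of x2 y2 A B x3 y3] R Q QR xy by metis
  have U: "Affine u (- (l1 * u + m1)) \<in> ec_points A B"
    and V: "Affine v (- (l2 * v + m2)) \<in> ec_points A B"
    using ec_add_closed P(1) Q(1) R(1) c1(4) c2(4) by metis+
  obtain l3 m3 s where c3: "chord A B l3 m3 u x3 s" "- (l1 * u + m1) = l3 * u + m3"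
      "y3 = l3 * x3 + m3" "ec_add A (ec_add A P Q) R = Affine s (- (l3 * s + m3))"
    using ec_add_chord_exists[of u "- (l1 * u + m1)" A B x3 y3] U R PQR(1) xy c1(4) by metis
  obtain l4 m4 t where c4: "chord A B l4 m4 x1 v t" "y1 = l4 * x1 + m4"
      "- (l2 * v + m2) = l4 * v + m4" "ec_add A P (ec_add A Q R) = Affine t (- (l4 * t + m4))"
    using ec_add_chord_exists[of x1 y1 A B v "- (l2 * v + m2)"] V P PQR(2) xy c2(4) by metis
  have x31: "x3 \<noteq> x1" and x32: "x3 \<noteq> x2"
    using same_x_cases P(1) Q(1) R(1) PR QR xy by metis+
  have x3u: "y3 \<noteq> l1 * u + m1" if "x3 = u"
    using PQR(1) c1(4) that xy by auto
  \<comment> \<open>If P = Q and Q+R had the abscissa of P, then Q+R would be Q, since -P is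
    excluded, and R would be \<open>Infinity\<close>.\<close>
  have tangent: "v \<noteq> x1" if "x1 = x2"
  proof
    assume "v = x1"
    have "P = Q" using same_x_cases P(1) Q(1) PQ xy that by metis
    then have "ec_add A Q R = Q"
      using same_x_cases[OF V] P(1) PQR(2) c2(4) xy \<open>v = x1\<close> by (metis ec_neg_neg)
    then have "R = ec_add A Q (ec_neg Q)"
      using ec_add_minus_cancel[OF R(1) Q(1)] ec_add_commute[OF R(1) Q(1)] by simp
    then show False using R by simp
  qed
  show ?thesis
    using chords_assoc[OF c1(1) c2(1) c3(1) c4(1) c3(2)[symmetric] c4(3)[symmetric] c1(2) c4(2)
        c1(3) c2(2) c2(3) c3(3) x31 x32 x3u tangent] c3(4) c4(4) by metis
qed

text \<open>The degenerate cases reduce to commutativity and cancellation; the remaining ones are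
  generic.\<close>

lemma ec_add_assoc:
  assumes P: "P \<in> ec_points A B" and Q: "Q \<in> ec_points A B" and R: "R \<in> ec_points A B"
  shows "ec_add A (ec_add A P Q) R = ec_add A P (ec_add A Q R)"
proof -
  note comm = ec_add_commute and closed = ec_add_closed
  have cancel: "ec_add A (ec_add A X (ec_neg Y)) Y = X"
    if "X \<in> ec_points A B" "Y \<in> ec_points A B" for X Y
    using ec_add_minus_cancel[of X "ec_neg Y"] that by simp
  consider "P = Infinity \<or> Q = Infinity \<or> R = Infinity" | "P = ec_neg Q" | "Q = ec_neg R"
    | "P = ec_neg R" | "P = R" | "ec_add A P Q = ec_neg R" | "P = ec_neg (ec_add A Q R)"
    | (generic) "P \<noteq> Infinity" "Q \<noteq> Infinity" "R \<noteq> Infinity" "P \<noteq> ec_neg Q" "Q \<noteq> ec_neg R"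
        "P \<noteq> ec_neg R" "P \<noteq> R" "ec_add A P Q \<noteq> ec_neg R" "P \<noteq> ec_neg (ec_add A Q R)"
    by blast
  then show ?thesis
  proof cases
    case 1
    then show ?thesis by auto
  next
    case 2
    have "ec_add A P (ec_add A Q R) = ec_add A (ec_add A R Q) (ec_neg Q)"
      using 2 comm closed Q R by simp
    then show ?thesis using 2 ec_add_minus_cancel Q R by simp
  next
    case 3
    then show ?thesis using cancel[OF P R] R by simp
  next
    case 4
    have "ec_add A (ec_add A P Q) R = ec_add A (ec_add A Q P) (ec_neg P)"
      using 4 comm P Q by simp
    moreover have "ec_add A P (ec_add A Q R) = ec_add A (ec_add A Q (ec_neg P)) P"
      using 4 comm closed P Q R by (metis ec_neg_neg)
    ultimately show ?thesis using ec_add_minus_cancel cancel P Q by simp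
  next
    case 5
    then show ?thesis using comm closed P Q by metis
  next
    case 6
    have "R = ec_add A (ec_neg P) (ec_neg Q)" using 6 ec_neg_add[OF P Q] by simp
    then have "ec_add A Q R = ec_neg P" using cancel[of "ec_neg P" Q] comm P Q R by simp
    then show ?thesis using 6 R by simp
  next
    case 7
    have "P = ec_add A (ec_neg R) (ec_neg Q)" using 7 ec_neg_add[OF Q R] comm Q R by simp
    then have "ec_add A P Q = ec_neg R" using cancel[of "ec_neg R" Q] Q R by simp
    then show ?thesis using 7 closed Q R
      by simp
  next
    case generic
    show ?thesis
    proof (cases "Q = R")
      case False
      then show ?thesis using ec_add_assoc_generic generic P Q R by simp
    next
      case True
      \<comment> \<open>The generic lemma admits a repeated point in the first two places only, so
        commutativity moves the double there.\<close>
      have "ec_add A (ec_add A Q Q) P = ec_add A Q (ec_add A Q P)"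
      proof (rule ec_add_assoc_generic)
        show "ec_add A Q Q \<noteq> ec_neg P" using generic True by (metis ec_neg_neg)
        show "Q \<noteq> ec_neg (ec_add A Q P)" using generic True comm P Q by (metis ec_neg_neg)
      qed (use generic True P Q in \<open>auto simp del: ec_neg.simps\<close>)
      then show ?thesis using True comm closed P Q by metis
    qed
  qed
qed

lemma comm_group_mordell_weil: "comm_group (mordell_weil A B)"
proof (rule comm_groupI)
  fix P assume "P \<in> carrier (mordell_weil A B)"
  then show "\<exists>Q \<in> carrier (mordell_weil A B). Q \<otimes>\<^bsub>mordell_weil A B\<^esub> P = \<one>\<^bsub>mordell_weil A B\<^esub>"
    by (intro bexI[of _ "ec_neg P"]) (auto simp: mordell_weil_def)
qed (simp_all add: mordell_weil_def ec_add_closed ec_add_assoc, rule ec_add_commute)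

end

section \<open>Local conditions on squares modulo a cubic\<close>

text \<open>The exponent \<open>p - 1\<close> is even, so \<open>z\<close> may be replaced by its
  absolute value.\<close>

lemma fermat_theorem_int:
  fixes z :: int
  assumes "prime p" "odd p" "\<not> int p dvd z"
  shows "[z ^ (p - 1) = 1] (mod int p)"
proof -
  have "\<not> p dvd nat \<bar>z\<bar>" using assms(3)
    by (metis abs_dvd_iff dvd_abs_iff int_dvd_int_iff nat_0_le abs_ge_zero)
  then have "[nat \<bar>z\<bar> ^ (p - 1) = 1] (mod p)" by (rule fermat_theorem[OF assms(1)])
  then have "[int (nat \<bar>z\<bar> ^ (p - 1)) = int 1] (mod int p)" by (simp only: cong_int_iff)
  moreover have "int (nat \<bar>z\<bar> ^ (p - 1)) = z ^ (p - 1)"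
    using assms(2) by (simp add: power_even_abs)
  ultimately show ?thesis by simp
qed

text \<open>Euler's criterion for a residue \<open>U\<close> whose lifts \<open>s\<close> become
  squares to any \<open>p\<close>-adic precision after clearing a denominator \<open>D\<close>
  independent of the precision.\<close>

lemma euler_of_approximate_square:
  fixes D U :: int
  assumes p: "prime p" "odd p" and "D \<noteq> 0" and U: "\<not> int p dvd U"
    and approx: "\<And>N. \<exists>z s. [s = U] (mod int p) \<and> int p ^ N dvd D^2 * s - z^2"
  shows "[U ^ ((p - 1) div 2) = 1] (mod int p)"
proof -
  let ?p = "int p" and ?k = "(p - 1) div 2"
  define v where "v = multiplicity ?p D"
  have pp: "prime ?p" using p by simp
  obtain D' where D: "D = ?p ^ v * D'" "\<not> ?p dvd D'"
    using multiplicity_decompose'[of D ?p] assms(3) pp unfolding v_def by (metis not_prime_unit)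
  \<comment> \<open>Removing the \<open>p\<close>-part of \<open>D^2\<close> costs
    \<open>2 * v\<close> powers of \<open>p\<close>; one more remains for a congruence modulo
    \<open>p\<close>.\<close>
  obtain z s where s: "[s = U] (mod ?p)" and z: "?p ^ (2 * v + 1) dvd D^2 * s - z^2"
    using approx by blast
  have "?p ^ (2 * v) dvd D^2 * s - z^2" using z by (meson dvd_trans le_imp_power_dvd le_add1)
  moreover have pv: "(?p ^ v)^2 = ?p ^ (2 * v)" by (simp add: power_mult mult.commute flip: power_mult)
  moreover have "(?p ^ v)^2 dvd D^2 * s" by (simp add: D(1) power_mult_distrib)
  ultimately have "(?p ^ v)^2 dvd z^2" by (metis dvd_diff_right_iff)
  then have "?p ^ v dvd z" by simp
  then obtain y where y: "z = ?p ^ v * y" by (rule dvdE)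
  have "D^2 * s - z^2 = ?p ^ (2 * v) * (D'^2 * s - y^2)"
    by (simp add: D(1) y power_mult_distrib right_diff_distrib pv)
  then have "?p dvd D'^2 * s - y^2" using z pp by (simp add: power_add)
  then have "[D'^2 * s = y^2] (mod ?p)" by (simp add: cong_iff_dvd_diff)
  with s have sq: "[D'^2 * U = y^2] (mod ?p)" by (metis cong_scalar_left cong_sym cong_trans)
  have "\<not> ?p dvd D'^2 * U" using D(2) U pp by (simp add: prime_dvd_mult_iff prime_dvd_power_iff)
  then have "\<not> ?p dvd y" using sq by (metis cong_dvd_iff dvd_mult dvd_refl power2_eq_square dvd_trans)
  have even: "2 * ?k = p - 1" using p(2) by simp
  have "[(D'^2 * U) ^ ?k = (y^2) ^ ?k] (mod ?p)" using sq by (rule cong_pow)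
  then have "[D' ^ (p - 1) * U ^ ?k = y ^ (p - 1)] (mod ?p)"
    by (simp only: power_mult_distrib even flip: power_mult)
  moreover have "[D' ^ (p - 1) * U ^ ?k = 1 * U ^ ?k] (mod ?p)"
    using fermat_theorem_int[OF p D(2)] by (rule cong_mult) simp
  ultimately have "[U ^ ?k = y ^ (p - 1)] (mod ?p)" by (metis cong_sym cong_trans mult_1)
  then show ?thesis using fermat_theorem_int[OF p \<open>\<not> ?p dvd y\<close>] cong_trans by blast
qed

text \<open>Newton's step \<open>s + t * q\<close> with \<open>q = p ^ Suc n\<close>: the derivative
  is invertible modulo \<open>p\<close>, so \<open>t\<close> can be chosen to kill the next digit of
  the value of the cubic.\<close>

lemma hensel_cubic:
  fixes a b r :: int
  assumes p: "prime p" and root: "p dvd r^3 + a * r + b" and simple: "\<not> p dvd 3 * r^2 + a"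
  shows "\<exists>s. [s = r] (mod p) \<and> p ^ N dvd s^3 + a * s + b"
proof -
  have "\<exists>s. [s = r] (mod p) \<and> p ^ Suc n dvd s^3 + a * s + b" for n
  proof (induction n)
    case 0
    then show ?case using root by (intro exI[of _ r]) simp
  next
    case (Suc n)
    then obtain s where s: "[s = r] (mod p)" "p ^ Suc n dvd s^3 + a * s + b" by blast
    define q where "q = p ^ Suc n"
    obtain e where e: "s^3 + a * s + b = q * e" using s(2) unfolding q_def by (rule dvdE)
    have "[3 * s^2 + a = 3 * r^2 + a] (mod p)"
      using s(1) by (intro cong_add cong_mult cong_pow cong_refl)
    then have "\<not> p dvd 3 * s^2 + a" using simple cong_dvd_iff by blast
    then have "coprime (3 * s^2 + a) p" using p by (metis coprime_commute prime_imp_coprime)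
    then obtain w where w: "[(3 * s^2 + a) * w = 1] (mod p)" using cong_solve_coprime_int by blast
    define t where "t = - (e * w)"
    have "[e + t * (3 * s^2 + a) = e + - e * 1] (mod p)"
      unfolding t_def using cong_scalar_left[OF w, of "- e"]
      by (intro cong_add cong_refl) (simp add: mult_ac)
    then have "p dvd e + t * (3 * s^2 + a)" by (simp add: cong_0_iff)
    moreover have "p dvd q" by (simp add: q_def)
    ultimately have "p dvd e + t * (3 * s^2 + a) + q * (t^2 * (3 * s + t * q))" by simp
    then have "q * p dvd q * (e + t * (3 * s^2 + a) + q * (t^2 * (3 * s + t * q)))"
      by (rule mult_dvd_mono[OF dvd_refl])
    also have "q * (e + t * (3 * s^2 + a) + q * (t^2 * (3 * s + t * q)))
        = q * e + ((s + t * q)^3 + a * (s + t * q) + b - (s^3 + a * s + b))"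
      by (simp add: power2_eq_square power3_eq_cube algebra_simps)
    also have "\<dots> = (s + t * q)^3 + a * (s + t * q) + b" by (simp add: e)
    finally have "p ^ Suc (Suc n) dvd (s + t * q)^3 + a * (s + t * q) + b"
      by (simp add: q_def mult.commute)
    moreover have "[s + t * q = r + t * 0] (mod p)"
      using s(1) \<open>p dvd q\<close> by (intro cong_add cong_mult cong_refl) (simp_all add: cong_0_iff)
    ultimately show ?case by (intro exI[of _ "s + t * q"]) simp
  qed
  from this[of N] show ?thesis by (meson dvd_trans le_imp_power_dvd lessI less_imp_le)
qed

text \<open>One \<open>D\<close> must serve all arguments, because the approximate root at which
  \<open>g\<close> is evaluated changes with the precision.\<close>

lemma poly_common_denominator:
  fixes g :: "rat poly"
  shows "\<exists>D::int. D \<noteq> 0 \<and> (\<forall>r::int. of_int D * poly g (of_int r) \<in> \<int>)"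
proof (induction g)
  case 0
  then show ?case by (intro exI[of _ 1]) simp
next
  case (pCons c g)
  then obtain D :: int where D: "D \<noteq> 0" "\<And>r::int. of_int D * poly g (of_int r) \<in> \<int>" by blast
  obtain n d where c: "c = of_int n / of_int d" "d > 0" by (cases c) (auto simp: Fract_of_int_quotient)
  have "of_int (d * D) * poly (pCons c g) (of_int r) \<in> \<int>" for r
  proof -
    have "of_int (d * D) * poly (pCons c g) (of_int r)
        = of_int (D * n) + of_int (d * r) * (of_int D * poly g (of_int r))"
      using c by (simp add: field_simps)
    then show ?thesis using D(2)[of r] by simp
  qed
  then show ?case using D(1) c(2) by (intro exI[of _ "d * D"]) simp
qed

definition cubic :: "'a::field_char_0 \<Rightarrow> 'a \<Rightarrow> 'a poly" where
  "cubic A B = [:B, A, 0, 1:]"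

lemma poly_cubic [simp]: "poly (cubic A B) x = x^3 + A * x + B"
  by (simp add: cubic_def power3_eq_cube algebra_simps)

section \<open>Squares in the quotient by a polynomial\<close>

definition square_mod :: "'a::field poly \<Rightarrow> 'a poly \<Rightarrow> bool" where
  "square_mod F u \<longleftrightarrow> (\<exists>k. F dvd u - k^2)"

lemma square_mod_mult:
  assumes "square_mod F u" "square_mod F v"
  shows "square_mod F (u * v)"
proof -
  obtain k l where "F dvd u - k^2" "F dvd v - l^2" using assms by (auto simp: square_mod_def)
  moreover have "u * v - (k * l)^2 = u * (v - l^2) + l^2 * (u - k^2)"
    by (simp add: power_mult_distrib algebra_simps)
  ultimately show ?thesis unfolding square_mod_def by (metis dvd_add dvd_mult)
qed

text \<open>\<open>w\<close> is an inverse of \<open>v\<close> modulo \<open>F\<close>, so a square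
  root of \<open>u * v^2\<close> times \<open>w\<close> is one of \<open>u\<close>.\<close>

lemma square_mod_cancel:
  assumes "square_mod F (u * v^2)" "F dvd v * w - 1"
  shows "square_mod F u"
proof -
  obtain k where "F dvd u * v^2 - k^2" using assms by (auto simp: square_mod_def)
  moreover have "u - (w * k)^2 = w^2 * (u * v^2 - k^2) - u * (v * w + 1) * (v * w - 1)"
    by (simp add: power2_eq_square algebra_simps)
  ultimately show ?thesis unfolding square_mod_def using assms(2) by (metis dvd_diff dvd_mult)
qed

text \<open>
  A square modulo the cubic, evaluated at a \<open>p\<close>-adic root of the cubic, is a \<open>p\<close>-adic square; the
  root is approximated by Hensel lifting of \<open>r\<close>.
\<close>

lemma square_mod_cubic_character:
  fixes a b r :: int and x :: "'i \<Rightarrow> int"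
  assumes p: "prime p" "odd p"
    and root: "int p dvd r^3 + a * r + b" and simple: "\<not> int p dvd 3 * r^2 + a"
    and sq: "square_mod (cubic (of_int a) (of_int b :: rat)) (\<Prod>i\<in>I. [:of_int (x i), - 1:])"
    and unit: "\<And>i. i \<in> I \<Longrightarrow> \<not> int p dvd x i - r"
  shows "[(\<Prod>i\<in>I. (x i - r) ^ ((p - 1) div 2)) = 1] (mod int p)"
proof (cases "finite I")
  case True
  define U where "U s = (\<Prod>i\<in>I. x i - s)" for s
  have pp: "prime (int p)" using p(1) by simp
  obtain k g where kg: "(\<Prod>i\<in>I. [:of_int (x i), - 1:]) - k^2 = cubic (of_int a) (of_int b :: rat) * g"
    using sq by (auto simp: square_mod_def)
  have eval: "of_int (U s) = poly k (of_int s) ^ 2 + of_int (s^3 + a * s + b) * poly g (of_int s)" for s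
  proof -
    have "of_int (U s) - poly k (of_int s) ^ 2
        = poly ((\<Prod>i\<in>I. [:of_int (x i), - 1:]) - k^2) (of_int s)"
      by (simp add: U_def poly_prod)
    also have "\<dots> = of_int (s^3 + a * s + b) * poly g (of_int s)" by (simp add: kg)
    finally show ?thesis by simp
  qed
  obtain D E :: int where D: "D \<noteq> 0" "\<And>s::int. of_int D * poly k (of_int s) \<in> \<int>"
    and E: "E \<noteq> 0" "\<And>s::int. of_int E * poly g (of_int s) \<in> \<int>"
    using poly_common_denominator by meson
  have "[U r ^ ((p - 1) div 2) = 1] (mod int p)"
  proof (rule euler_of_approximate_square[OF p, of "D * E"])
    show "D * E \<noteq> 0" using D(1) E(1) by simp
    show "\<not> int p dvd U r" using unit True pp by (simp add: U_def prime_dvd_prod_iff)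
    fix N
    obtain s where s: "[s = r] (mod int p)" "int p ^ N dvd s^3 + a * s + b"
      using hensel_cubic[OF pp root simple] by blast
    obtain y z where y: "of_int D * poly k (of_int s) = of_int y"
      and z: "of_int E * poly g (of_int s) = of_int z"
      using D(2)[of s] E(2)[of s] by (metis Ints_cases)
    \<comment> \<open>Multiplying by \<open>(D * E)^2\<close> makes everything integral; the term
      besides the square contains the value of the cubic at \<open>s\<close>, divisible by
      \<open>int p ^ N\<close>.\<close>
    have "(of_int ((D * E)^2 * U s) :: rat) = (of_int E * (of_int D * poly k (of_int s))) ^ 2
        + of_int (D^2 * E * (s^3 + a * s + b)) * (of_int E * poly g (of_int s))"
      unfolding of_int_mult[of _ "U s"] eval by (simp add: power2_eq_square algebra_simps)
    also have "\<dots> = of_int ((E * y)^2 + D^2 * E * (s^3 + a * s + b) * z)"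
      unfolding y z by simp
    finally have "(D * E)^2 * U s = (E * y)^2 + D^2 * E * (s^3 + a * s + b) * z"
      by (simp only: of_int_eq_iff)
    then have "int p ^ N dvd (D * E)^2 * U s - (E * y)^2" using s(2) by simp
    moreover have "[U s = U r] (mod int p)"
      unfolding U_def by (intro cong_prod cong_diff cong_refl s(1))
    ultimately show "\<exists>z u. [u = U r] (mod int p) \<and> int p ^ N dvd (D * E)^2 * u - z^2" by blast
  qed
  then show ?thesis by (simp add: U_def prod_power_distrib)
qed simp

section \<open>Two-descent\<close>

text \<open>
  The descent map sends an affine point with abscissa \<open>x\<close> to the class of \<open>x - X\<close> in the quotient
  of the polynomial ring by the cubic, modulo squares.
\<close>

fun descent :: "'a::field_char_0 ec_point \<Rightarrow> 'a poly" where
  "descent Infinity = 1"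
| "descent (Affine x y) = [:x, - 1:]"

lemma descent_neg [simp]: "descent (ec_neg P) = descent P"
  by (cases P) auto

lemma square_mod_power2: "square_mod F (u^2)"
  unfolding square_mod_def by (metis cancel_comm_monoid_add_class.diff_cancel dvd_0_right)

text \<open>The chord identity with signs changed: three collinear points have classes whose product
  is the square of \<open>l X + m\<close> modulo the cubic.\<close>

lemma descent_chord:
  assumes "chord A B l m x1 x2 x3"
  shows "[:x1, - 1:] * [:x2, - 1:] * [:x3, - 1:] - [:m, l:]^2 = - cubic A B"
  unfolding cubic_def chord_eqs(2,3)[OF assms] chord_eqs(1)[OF assms]
  by (simp add: power2_eq_square algebra_simps)

text \<open>For the cubic f, \<open>x - X\<close> divides f(x) - f(X), and f(x) is nonzero; the
  cofactor divided by f(x) is the inverse.\<close>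

lemma descent_unit:
  fixes A B :: "'a::field_char_0"
  assumes "P \<in> ec_points A B" "\<And>x. x^3 + A * x + B \<noteq> 0"
  obtains w where "cubic A B dvd descent P * w - 1"
proof (cases P)
  case Infinity
  then show ?thesis using that[of 1] by simp
next
  case (Affine x y)
  let ?c = "x^3 + A * x + B"
  have "[:x, - 1:] * [:x^2 + A, x, 1:] = [:?c:] - cubic A B"
    by (simp add: cubic_def power2_eq_square power3_eq_cube algebra_simps)
  then have "descent P * smult (1 / ?c) [:x^2 + A, x, 1:] - 1 = smult (1 / ?c) ([:?c:] - cubic A B) - 1"
    by (simp only: Affine descent.simps mult_smult_right)
  also have "\<dots> = smult (- 1 / ?c) (cubic A B)"
    using assms(2)[of x] by (simp add: smult_diff_right)
  finally show ?thesis using that by (metis dvd_refl dvd_smult)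
qed

context weierstrass_curve
begin

abbreviation E where "E \<equiv> mordell_weil A B"

lemma carrier_E [simp]: "carrier E = ec_points A B" and one_E [simp]: "\<one>\<^bsub>E\<^esub> = Infinity"
  and mult_E [simp]: "P \<otimes>\<^bsub>E\<^esub> Q = ec_add A P Q"
  by (simp_all add: mordell_weil_def)

text \<open>Multiplicativity modulo squares. The sum may stand as a third factor, as a class modulo
  squares is its own inverse.\<close>

lemma square_mod_descent_add:
  assumes "P \<in> ec_points A B" "Q \<in> ec_points A B"
  shows "square_mod (cubic A B) (descent P * descent Q * descent (ec_add A P Q))"
proof (cases "P = Infinity \<or> Q = Infinity \<or> P = ec_neg Q")
  case True
  then have "descent P * descent Q * descent (ec_add A P Q) \<in> {descent P ^ 2, descent Q ^ 2}"
    by (auto simp: power2_eq_square)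
  then show ?thesis using square_mod_power2 by (metis insertE singletonD)
next
  case False
  then obtain x1 y1 x2 y2 where PQ: "P = Affine x1 y1" "Q = Affine x2 y2"
    by (metis ec_point.exhaust)
  obtain l m x3 where c: "chord A B l m x1 x2 x3" "ec_add A P Q = Affine x3 (- (l * x3 + m))"
    using ec_add_chord_exists[of x1 y1 A B x2 y2] assms False PQ by metis
  have "cubic A B dvd descent P * descent Q * descent (ec_add A P Q) - [:m, l:]^2"
    using descent_chord[OF c(1)] by (simp only: PQ c(2)[unfolded PQ] descent.simps dvd_minus_iff dvd_refl)
  then show ?thesis unfolding square_mod_def by blast
qed

context
  assumes no_root: "\<And>x. x^3 + A * x + B \<noteq> 0"
begin

lemma square_mod_descent_cancel:
  assumes "P \<in> ec_points A B" "square_mod (cubic A B) (u * descent P ^ 2)"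
  shows "square_mod (cubic A B) u"
  using descent_unit[OF assms(1) no_root] square_mod_cancel[OF assms(2)] by blast

text \<open>In the induction the partial sum enters twice; its class is a unit, so the resulting
  square cancels.\<close>

lemma square_mod_descent_finprod:
  assumes "finite T" "T \<subseteq> ec_points A B"
  shows "square_mod (cubic A B) (descent (finprod E (\<lambda>P. P) T) * (\<Prod>P\<in>T. descent P))"
  using assms
proof (induction T)
  case empty
  interpret comm_group E by (rule comm_group_mordell_weil)
  show ?case using square_mod_power2[of _ 1] by simp
next
  case (insert P T)
  interpret comm_group E by (rule comm_group_mordell_weil)
  let ?M = "finprod E (\<lambda>P. P) T"
  have M: "?M \<in> ec_points A B" using insert.prems finprod_closed[of "\<lambda>P. P" T] by auto
  have PM: "finprod E (\<lambda>P. P) (insert P T) = ec_add A P ?M"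
    using insert by (subst finprod_insert) auto
  have "square_mod (cubic A B) ((descent P * descent ?M * descent (ec_add A P ?M))
      * (descent ?M * (\<Prod>P\<in>T. descent P)))"
    using square_mod_mult[OF square_mod_descent_add[OF _ M] insert.IH] insert.prems by blast
  also have "\<dots> = (descent (ec_add A P ?M) * (\<Prod>P\<in>insert P T. descent P)) * descent ?M ^ 2"
    using insert by (simp add: power2_eq_square mult_ac)
  finally show ?case using square_mod_descent_cancel[OF M] unfolding PM by blast
qed

lemma square_mod_descent_double:
  assumes "Q \<in> ec_points A B"
  shows "square_mod (cubic A B) (descent (ec_add A Q Q))"
proof -
  have "square_mod (cubic A B) (descent (ec_add A Q Q) * descent Q ^ 2)"
    using square_mod_descent_add[OF assms assms] by (simp add: power2_eq_square mult_ac)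
  then show ?thesis using square_mod_descent_cancel[OF assms] by blast
qed

lemma square_mod_descent_of_double:
  assumes "finite T" "T \<subseteq> ec_points A B" "Q \<in> ec_points A B"
    and "finprod E (\<lambda>P. P) T = ec_add A Q Q"
  shows "square_mod (cubic A B) (\<Prod>P\<in>T. descent P)"
proof -
  have "square_mod (cubic A B) ((\<Prod>P\<in>T. descent P) * descent (ec_add A Q Q) ^ 2)"
    using square_mod_mult[OF square_mod_descent_finprod[OF assms(1,2)] square_mod_descent_double[OF assms(3)]]
    by (simp add: assms(4) power2_eq_square mult_ac)
  then show ?thesis using square_mod_descent_cancel ec_add_closed[OF assms(3,3)] by blast
qed

lemma no_two_torsion:
  assumes "P \<in> ec_points A B" "ec_add A P P = Infinity"
  shows "P = Infinity"
proof (cases P)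
  case (Affine x y)
  then have "y = - y" using assms(2) by (auto simp: Let_def split: if_splits)
  then have "y + y = 0" by (simp only: eq_neg_iff_add_eq_0)
  then have "2 * y = 0" by (simp only: mult_2)
  then have "y = 0" by simp
  then show ?thesis using assms(1) no_root[of x] Affine by simp
qed simp

end

end

text \<open>Infinite descent on the coefficients of a relation: all of them are even, so it can be halved.\<close>

lemma (in comm_group) int_independentI:
  assumes "finite S" "S \<subseteq> carrier G"
    and torsion: "\<And>x. x \<in> carrier G \<Longrightarrow> x \<otimes> x = \<one> \<Longrightarrow> x = \<one>"
    and halving: "\<And>T q. T \<subseteq> S \<Longrightarrow> q \<in> carrier G \<Longrightarrow> finprod G (\<lambda>x. x) T = q \<otimes> q \<Longrightarrow> T = {}"
  shows "int_independent G S"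
proof -
  have "\<forall>x\<in>S. n x = 0" if "finprod G (\<lambda>x. x [^] n x) S = \<one>" for n :: "'a \<Rightarrow> int"
    using that
  proof (induction "\<Sum>x\<in>S. nat \<bar>n x\<bar>" arbitrary: n rule: less_induct)
    case less
    \<comment> \<open>\<open>div\<close> rounds down, so \<open>n x\<close> is
      \<open>2 * m x\<close> plus 0 or 1 also for negative \<open>n x\<close>.\<close>
    define m where "m x = n x div 2" for x
    define T where "T = {x \<in> S. odd (n x)}"
    let ?M = "finprod G (\<lambda>x. x [^] m x) S"
    let ?N = "finprod G (\<lambda>x. x) T"
    have M: "?M \<in> carrier G" using assms(2) by (intro finprod_closed) auto
    have N: "?N \<in> carrier G" using assms(2) by (intro finprod_closed) (auto simp: T_def)
    have split: "x [^] n x = (x [^] m x \<otimes> x [^] m x) \<otimes> (if odd (n x) then x else \<one>)" if "x \<in> S" for x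
    proof -
      have x: "x \<in> carrier G" using that assms(2) by auto
      have "n x = m x + m x + (if odd (n x) then 1 else 0)" unfolding m_def by presburger
      then have "x [^] n x = x [^] (m x + m x + (if odd (n x) then 1 else 0))" by simp
      also have "\<dots> = (x [^] m x \<otimes> x [^] m x) \<otimes> (x [^] (if odd (n x) then 1 else 0 :: int))"
        using x by (simp only: int_pow_mult)
      finally show ?thesis using x by (simp add: int_pow_1 split: if_splits)
    qed
    have "finprod G (\<lambda>x. x [^] n x) S
        = finprod G (\<lambda>x. (x [^] m x \<otimes> x [^] m x) \<otimes> (if odd (n x) then x else \<one>)) S"
      using assms(2) by (intro finprod_cong') (auto simp: split)
    also have "\<dots> = (?M \<otimes> ?M) \<otimes> finprod G (\<lambda>x. if odd (n x) then x else \<one>) S"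
      using assms(2) by (subst finprod_multf, force, force, subst finprod_multf) force+
    also have "finprod G (\<lambda>x. if odd (n x) then x else \<one>) S = ?N"
      unfolding T_def using assms(1,2) by (intro finprod_mono_neutral_cong_right) auto
    finally have MN: "(?M \<otimes> ?M) \<otimes> ?N = \<one>" using less.prems by simp
    then have "?N \<otimes> (?M \<otimes> ?M) = \<one>" using M N by (simp add: m_comm)
    then have "inv (?M \<otimes> ?M) = ?N" using M N by (intro inv_equality) auto
    then have "?N = inv ?M \<otimes> inv ?M" using M by (simp add: inv_mult)
    then have "T = {}" using halving[of T "inv ?M"] M by (auto simp: T_def)
    then have even: "n x = 2 * m x" if "x \<in> S" for x using that by (auto simp: T_def m_def)
    have "?M = \<one>" using MN M torsion[OF M] \<open>T = {}\<close> by simp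
    show ?case
    proof (cases "\<forall>x\<in>S. n x = 0")
      case False
      then obtain x where x: "x \<in> S" "n x \<noteq> 0" by blast
      have "(\<Sum>x\<in>S. nat \<bar>m x\<bar>) < (\<Sum>x\<in>S. nat \<bar>n x\<bar>)"
      proof (rule sum_strict_mono_ex1[OF assms(1)])
        show "\<forall>x\<in>S. nat \<bar>m x\<bar> \<le> nat \<bar>n x\<bar>" using even by auto
        show "\<exists>x\<in>S. nat \<bar>m x\<bar> < nat \<bar>n x\<bar>" using even[OF x(1)] x by (intro bexI[of _ x]) auto
      qed
      then have "\<forall>x\<in>S. m x = 0" using less.hyps \<open>?M = \<one>\<close> by blast
      then show ?thesis using even by simp
    qed
  qed
  then show ?thesis using assms(1,2) by (auto simp: int_independent_def)
qed

section \<open>Independence of integral points from quadratic characters\<close>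

text \<open>If a subset of the points sums to a double, each character has product 1 over it. The
  character dual to one of its members has product -1, so the subset is empty.\<close>

lemma int_independent_of_dual_characters:
  fixes a b :: int and L :: "(int \<times> int) set"
  defines "pt \<equiv> \<lambda>(x, y). Affine (of_int x :: rat) (of_int y)"
  assumes "elliptic_curve (of_int a :: rat) (of_int b)"
    and no_root: "\<And>x :: rat. x^3 + of_int a * x + of_int b \<noteq> 0"
    and "finite L" and on_curve: "\<And>x y. (x, y) \<in> L \<Longrightarrow> y^2 = x^3 + a * x + b"
    and dual: "\<And>x y. (x, y) \<in> L \<Longrightarrow> \<exists>p r. prime p \<and> odd p \<and> int p dvd r^3 + a * r + b \<and>
      \<not> int p dvd 3 * r^2 + a \<and> (\<forall>(x', y') \<in> L. [(x' - r) ^ ((p - 1) div 2)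
        = (if (x', y') = (x, y) then - 1 else 1)] (mod int p))"
  shows "int_independent (mordell_weil (of_int a :: rat) (of_int b)) (pt ` L)"
proof -
  interpret weierstrass_curve "of_int a :: rat" "of_int b" by unfold_locales fact
  interpret comm_group E by (rule comm_group_mordell_weil)
  have pt_closed: "pt P \<in> ec_points (of_int a) (of_int b)" if "P \<in> L" for P
  proof (cases P)
    case (Pair x y)
    then have "(of_int (y^2) :: rat) = of_int (x^3 + a * x + b)" using on_curve that by simp
    then show ?thesis by (simp add: pt_def Pair)
  qed
  have inj: "inj pt" by (auto simp: pt_def inj_def)
  show ?thesis
  proof (rule int_independentI)
    show "finite (pt ` L)" using assms by simp
    show "pt ` L \<subseteq> carrier E" using pt_closed by auto
    show "P = \<one>\<^bsub>E\<^esub>" if "P \<in> carrier E" "P \<otimes>\<^bsub>E\<^esub> P = \<one>\<^bsub>E\<^esub>" for P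
      using no_two_torsion[OF no_root] that by simp
    fix T Q assume T: "T \<subseteq> pt ` L" and Q: "Q \<in> carrier E"
      and TQ: "finprod E (\<lambda>P. P) T = Q \<otimes>\<^bsub>E\<^esub> Q"
    obtain I where I: "I \<subseteq> L" "T = pt ` I" using T by (metis subset_image_iff)
    have "finite I" using I assms finite_subset by blast
    have "square_mod (cubic (of_int a) (of_int b)) (\<Prod>P\<in>T. descent P)"
    proof (rule square_mod_descent_of_double[OF no_root])
      show "finite T" using I(2) \<open>finite I\<close> by simp
      show "T \<subseteq> ec_points (of_int a) (of_int b)" using T pt_closed by blast
      show "Q \<in> ec_points (of_int a) (of_int b)" "finprod E (\<lambda>P. P) T = ec_add (of_int a) Q Q"
        using Q TQ by simp_all
    qed
    moreover have "(\<Prod>P\<in>T. descent P) = (\<Prod>P\<in>I. [:of_int (fst P), - 1:])"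
      unfolding I(2) using inj
      by (subst prod.reindex)
        (auto simp: pt_def inj_def inj_on_def split: prod.splits intro!: prod.cong)
    ultimately have sq: "square_mod (cubic (of_int a) (of_int b :: rat))
        (\<Prod>P\<in>I. [:of_int (fst P), - 1:])" by simp
    show "T = {}"
    proof (rule ccontr)
      assume "T \<noteq> {}"
      then obtain x y where xy: "(x, y) \<in> I" using I by auto
      then obtain p r where p: "prime p" "odd p" and r: "int p dvd r^3 + a * r + b"
          "\<not> int p dvd 3 * r^2 + a" and chars: "\<And>P. P \<in> L \<Longrightarrow>
          [(fst P - r) ^ ((p - 1) div 2) = (if P = (x, y) then - 1 else 1)] (mod int p)"
        using dual[of x y] I(1) by (auto split: prod.splits)
      have "p > 2" using p prime_ge_2_nat[of p] by (cases "p = 2") auto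
      \<comment> \<open>The prescribed values 1 and -1 already exclude divisibility by
        \<open>p\<close>.\<close>
      have unit: "\<not> int p dvd fst P - r" if "P \<in> I" for P
      proof
        assume "int p dvd fst P - r"
        moreover have "0 < (p - 1) div 2" using \<open>p > 2\<close> by simp
        ultimately have "int p dvd (fst P - r) ^ ((p - 1) div 2)"
          by (blast intro: dvd_trans dvd_power)
        then have "int p dvd (if P = (x, y) then - 1 else 1)"
          using chars I(1) that cong_dvd_iff by blast
        then show False using \<open>p > 2\<close> by (auto split: if_splits)
      qed
      have "[(\<Prod>P\<in>I. (fst P - r) ^ ((p - 1) div 2)) = (\<Prod>P\<in>I. if P = (x, y) then - 1 else 1)] (mod int p)"
        using I(1) by (intro cong_prod chars) blast
      also have "(\<Prod>P\<in>I. if P = (x, y) then - 1 else 1 :: int) = - 1"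
        using \<open>finite I\<close> xy by (simp add: prod.delta)
      finally have "[1 = - 1 :: int] (mod int p)"
        using square_mod_cubic_character[OF p r sq unit] by (metis cong_sym cong_trans)
      then have "int p dvd 2" by (simp add: cong_iff_dvd_diff)
      then show False using \<open>p > 2\<close> by (auto dest: zdvd_imp_le)
    qed
  qed
qed

section \<open>Irreducibility and the explicit curve\<close>

text \<open>A rational root of a monic integral cubic is an integer \<open>n\<close>. The conditions
  force \<open>q dvd n\<close>, hence \<open>q^3\<close> divides \<open>n^3 + a * n\<close>, which
  is \<open>- b\<close>.\<close>

lemma cubic_no_rational_root:
  fixes a b q :: int and x :: rat
  assumes q: "prime q" "q^2 dvd a" "q dvd b" "\<not> q^3 dvd b"
  shows "x^3 + of_int a * x + of_int b \<noteq> 0"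
proof
  assume root: "x^3 + of_int a * x + of_int b = 0"
  have "algebraic_int x"
  proof (rule algebraic_int.intros)
    show "lead_coeff (cubic (of_int a) (of_int b :: rat)) = 1" by (simp add: cubic_def)
    show "\<forall>i. coeff (cubic (of_int a) (of_int b :: rat)) i \<in> \<int>"
      by (auto simp: cubic_def coeff_pCons split: nat.splits)
    show "poly (cubic (of_int a) (of_int b)) x = 0" using root by simp
  qed
  then have "x \<in> \<int>" by (rule rational_algebraic_int_is_int) (metis Rats_of_rat of_rat_eq_id id_apply)
  then obtain n where "x = of_int n" by (rule Ints_cases)
  with root have "of_int (n^3 + a * n + b) = (0 :: rat)" by simp
  then have n: "n^3 + a * n + b = 0" by (simp only: of_int_eq_0_iff)
  have "q dvd a" using q(2) by (metis dvd_mult_left power2_eq_square)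
  moreover have "n^3 = - (a * n + b)" using n by simp
  ultimately have "q dvd n^3" using q(3) by simp
  then have "q dvd n" using q(1) prime_dvd_power by blast
  then have "q^3 dvd n^3" "q^2 * q dvd a * n" using q(2) by (auto intro: mult_dvd_mono)
  then have "q^3 dvd - (n^3 + a * n)" by (simp add: power3_eq_cube power2_eq_square)
  moreover have "b = - (n^3 + a * n)" using n by simp
  ultimately show False using q(4) by simp
qed

theorem theorem2p2:
  fixes A B :: rat
  assumes "A = 1123187040185717205972"
    and "B = 50786893859117937639786031372848"
  shows "6 \<le> abelian_group_rank (mordell_weil A B)"
proof -
  define a b :: int where ab: "a = 1123187040185717205972" "b = 50786893859117937639786031372848"
  define L :: "(int \<times> int) set" where "L = {(-21256943307, 4160079135405999),
    (-14371678923, 5628179962953135),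
    (-13054927452, 5822267813027064),
    (-5865550026, 6633022066272000),
    (8377489974, 7796430841248000),
    (24465169974, 9638949614112000)}"
  define pt where "pt = (\<lambda>(x, y). Affine (of_int x :: rat) (of_int y))"
  have AB: "A = of_int a" "B = of_int b" using assms by (simp_all add: ab)
  have "int_independent (mordell_weil A B) (pt ` L)"
    unfolding AB pt_def
  proof (rule int_independent_of_dual_characters)
    show "elliptic_curve (of_int a :: rat) (of_int b)" using elliptic_curve_example by (simp add: ab)
    show "x^3 + of_int a * x + of_int b \<noteq> 0" for x :: rat
      by (rule cubic_no_rational_root[of 7]) (simp_all add: ab)
    show "finite L" by (simp add: L_def)
    show "y^2 = x^3 + a * x + b" if "(x, y) \<in> L" for x y
      using that by (auto simp: L_def ab)
    \<comment> \<open>The conditions in evaluable form: the base is reduced modulo \<open>p\<close>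
      before the power is taken, and -1 appears as its residue \<open>int p - 1\<close>.\<close>
    have char: "\<exists>p r. prime p \<and> odd p \<and> int p dvd r^3 + a * r + b \<and>
      \<not> int p dvd 3 * r^2 + a \<and> (\<forall>(x', y') \<in> L. [(x' - r) ^ ((p - 1) div 2)
        = (if (x', y') = (x, y) then - 1 else 1)] (mod int p))"
      if "prime p" "odd p" "(r^3 + a * r + b) mod int p = 0" "(3 * r^2 + a) mod int p \<noteq> 0"
        "\<forall>(x', y') \<in> L. ((x' - r) mod int p) ^ ((p - 1) div 2) mod int p
          = (if (x', y') = (x, y) then int p - 1 else 1)" for p r x y
    proof -
      have "1 < int p" using prime_gt_1_nat[OF that(1)] by simp
      then have "1 mod int p = 1" "- 1 mod int p = int p - 1" by (simp_all add: zmod_minus1)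
      then have "\<forall>(x', y') \<in> L. [(x' - r) ^ ((p - 1) div 2)
          = (if (x', y') = (x, y) then - 1 else 1)] (mod int p)"
        using that(5) by (auto simp: cong_def power_mod split: if_splits)
      moreover have "int p dvd r^3 + a * r + b" "\<not> int p dvd 3 * r^2 + a"
        using that(3,4) by (simp_all add: dvd_eq_mod_eq_0)
      ultimately show ?thesis using that(1,2) by (intro exI[of _ p] exI[of _ r] conjI)
    qed
    show "\<exists>p r. prime p \<and> odd p \<and> int p dvd r^3 + a * r + b \<and>
      \<not> int p dvd 3 * r^2 + a \<and> (\<forall>(x', y') \<in> L. [(x' - r) ^ ((p - 1) div 2)
        = (if (x', y') = (x, y) then - 1 else 1)] (mod int p))" if xy: "(x, y) \<in> L" for x y
    proof -
      consider "x = -21256943307" "y = 4160079135405999"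
        | "x = -14371678923" "y = 5628179962953135"
        | "x = -13054927452" "y = 5822267813027064"
        | "x = -5865550026" "y = 6633022066272000"
        | "x = 8377489974" "y = 7796430841248000"
        | "x = 24465169974" "y = 9638949614112000"
        using xy unfolding L_def by auto
      then show ?thesis
      proof cases
        case 1
        show ?thesis unfolding 1(1,2)
          by (rule char[of 37 8]) (simp_all only: L_def ab ball_simps prod.case, simp_all)
      next
        case 2
        show ?thesis unfolding 2(1,2)
          by (rule char[of 71 20]) (simp_all only: L_def ab ball_simps prod.case, simp_all)
      next
        case 3
        show ?thesis unfolding 3(1,2)
          \<comment> \<open>The prime 71 serves twice: 20 and 13 are different simple roots of the
            cubic modulo 71 and give different characters.\<close>
          by (rule char[of 71 13]) (simp_all only: L_def ab ball_simps prod.case, simp_all)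
      next
        case 4
        show ?thesis unfolding 4(1,2)
          by (rule char[of 13 8]) (simp_all only: L_def ab ball_simps prod.case, simp_all)
      next
        case 5
        show ?thesis unfolding 5(1,2)
          by (rule char[of 17 5]) (simp_all only: L_def ab ball_simps prod.case, simp_all)
      next
        case 6
        show ?thesis unfolding 6(1,2)
          by (rule char[of 31 29]) (simp_all only: L_def ab ball_simps prod.case, simp_all)
      qed
    qed
  qed
  moreover have "card (pt ` L) = 6"
  proof -
    have "inj pt" by (auto simp: pt_def inj_def)
    then have "card (pt ` L) = card L" by (intro card_image) (rule inj_on_subset, auto)
    then show ?thesis by (simp add: L_def)
  qed
  ultimately show ?thesis
    unfolding abelian_group_rank_def by (intro SUP_upper2[of "pt ` L"]) (auto simp: numeral_eq_enat)
qed

end
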